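(* Let $(X,d)$ be a metric space, let $f:X\to X$ be a self-mapping, let $\zeta\in\mathcal{Z}$ be a simulation function, let $0\le a<1$ be the number used in the definition of $M(x,y)$, and let $\rho=\inf\{d(x,fx): x\neq fx,\ x\in X\}$. Suppose there exist points $x_1,x_2\in X$ such that (a) for all $x\in E_\rho(x_1,x_2)$ there exists $\delta(\rho)>0$ satisfying $$\frac{\rho}{2}\le M(x,x_1)+M(x,x_2)<\frac{\rho}{2}+\delta(\rho)\ \Longrightarrow\ d(fx,x_1)+d(fx,x_2)\le\rho;$$ (b) for all $x\in X$, $$d(fx,x)>0\ \Longrightarrow\ \zeta\big(d(fx,x),M(x,x_1)\big)\ge 0\ \text{ and }\ \zeta\big(d(fx,x),M(x,x_2)\big)\ge 0;$$ (c) for all $x\in X$, $$d(fx,x)>0\ \Longrightarrow\ \zeta\left(d(fx,x),\frac{d(x,x_1)+d(fx,x_1)+d(x,x_2)+d(fx,x_2)}{2}\right)\ge 0.$$ Then $fx_1=x_1$, $fx_2=x_2$, and $Fix(f)$ contains the ellipse $E_\rho(x_1,x_2)$.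
   Context: $\mathcal{Z}$ is the set of simulation functions: functions $\zeta:[0,\infty)\times[0,\infty)\to\mathbb{R}$ such that ($\zeta_1$) $\zeta(0,0)=0$; ($\zeta_2$) $\zeta(t,s)<s-t$ for all $s,t>0$; ($\zeta_3$) if $\{t_n\},\{s_n\}$ are sequences in $(0,\infty)$ with $\lim_{n\to\infty}t_n=\lim_{n\to\infty}s_n>0$, then $\limsup_{n\to\infty}\zeta(t_n,s_n)<0$. For a self-mapping $f$ of a metric space $(X,d)$ write $fx=f(x)$ and $Fix(f)=\{x\in X: fx=x\}$. For a fixed number $0\le a<1$, $$M(x,y)=\max\left\{a\,d(x,fx)+(1-a)\,d(y,fy),\ (1-a)\,d(x,fx)+a\,d(y,fy),\ \frac{d(x,fy)+d(y,fx)}{2}\right\}.$$ For $x_1,x_2\in X$ and $r\in[0,\infty)$, the ellipse is $E_r(x_1,x_2)=\{x\in X: d(x,x_1)+d(x,x_2)=r\}$. *)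

theory Defs
  imports Complex_Main "HOL-Library.Extended_Real"
begin

text \<open>
  A simulation function has domain $[0,\infty)^2$; it is represented by a total function on the
  reals of which only the values at nonnegative arguments are constrained. The upper limit is
  taken in the extended reals, since the values need not be bounded below.
\<close>

definition simulation_function :: "(real \<Rightarrow> real \<Rightarrow> real) \<Rightarrow> bool" where
  "simulation_function \<zeta> \<longleftrightarrow>
     \<zeta> 0 0 = 0 \<and>
     (\<forall>t s. 0 < t \<longrightarrow> 0 < s \<longrightarrow> \<zeta> t s < s - t) \<and>
     (\<forall>(t :: nat \<Rightarrow> real) (s :: nat \<Rightarrow> real) L.
        (\<forall>n. 0 < t n) \<longrightarrow> (\<forall>n. 0 < s n) \<longrightarrow> t \<longlonglongrightarrow> L \<longrightarrow> s \<longlonglongrightarrow> L \<longrightarrow> 0 < L \<longrightarrow>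
        limsup (\<lambda>n. ereal (\<zeta> (t n) (s n))) < 0)"

definition Fix :: "('a \<Rightarrow> 'a) \<Rightarrow> 'a set" where
  "Fix f = {x. f x = x}"

definition M_max :: "real \<Rightarrow> ('a::metric_space \<Rightarrow> 'a) \<Rightarrow> 'a \<Rightarrow> 'a \<Rightarrow> real" where
  "M_max a f x y =
     Max {a * dist x (f x) + (1 - a) * dist y (f y),
          (1 - a) * dist x (f x) + a * dist y (f y),
          (dist x (f y) + dist y (f x)) / 2}"

definition ellipse :: "real \<Rightarrow> 'a::metric_space \<Rightarrow> 'a \<Rightarrow> 'a set" where
  "ellipse r x1 x2 = {x. dist x x1 + dist x x2 = r}"

text \<open>
  If \<open>f\<close> is the identity, the infimum is over the empty set and its value is an unspecified real.
\<close>

definition min_displacement :: "('a::metric_space \<Rightarrow> 'a) \<Rightarrow> real" where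
  "min_displacement f = Inf {dist x (f x) | x. x \<noteq> f x}"

end

(* Condition (zeta_2) turns the inequalities in (b) into d(x,fx) < M(x,x_i) for every moved point x.
   At x = x_i this is d(x_i,fx_i) < d(x_i,fx_i), so x_1 and x_2 are fixed. Then
   d(x,fx) < M(x,x_i) forces the last entry of the maximum to dominate, and the triangle inequality
   gives d(x,fx) < 2 d(x,x_i). Adding the two bounds on the ellipse yields d(x,fx) < \<rho>, which
   contradicts the choice of \<rho>. *)
theory Submission
  imports Defs
begin

lemma simulation_function_nonneg_less:
  assumes "simulation_function \<zeta>" "0 < t" "0 < s" "0 \<le> \<zeta> t s"
  shows "t < s"
proof -
  have "\<zeta> t s < s - t"
    using assms unfolding simulation_function_def by blast
  then show ?thesis
    using assms(4) by linarith
qed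

text \<open>The moved point itself makes the set nonempty, so the unspecified infimum of the empty
  set never enters.\<close>

lemma min_displacement_le:
  assumes "f x \<noteq> x"
  shows "min_displacement f \<le> dist x (f x)"
  unfolding min_displacement_def
proof (rule cInf_lower)
  show "dist x (f x) \<in> {dist x (f x) | x. x \<noteq> f x}"
    using assms by force
  show "bdd_below {dist x (f x) | x. x \<noteq> f x}"
    by (rule bdd_belowI[of _ 0]) auto
qed

text \<open>On the diagonal the weights \<open>a\<close> and \<open>1 - a\<close> add up to 1, so
  all three entries coincide.\<close>

lemma M_max_same: "M_max a f x x = dist x (f x)"
  unfolding M_max_def by (simp add: algebra_simps)

text \<open>Supplies the positive second argument that (zeta_2) requires. The second entry of the
  maximum is the witness, since the first vanishes for \<open>a = 0\<close>.\<close>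

lemma M_max_pos:
  assumes "a < 1" "f x \<noteq> x" "f y = y"
  shows "0 < M_max a f x y"
proof -
  have "0 < (1 - a) * dist x (f x)"
    using assms by simp
  then show ?thesis
    unfolding M_max_def using assms(3) by (simp add: less_max_iff_disj)
qed

lemma dist_less_if_less_M_max:
  assumes "0 \<le> a" "a < 1" "f y = y" "dist x (f x) < M_max a f x y"
  shows "dist x (f x) < 2 * dist x y"
proof -
  \<comment> \<open>As \<open>f y = y\<close>, these products are the first two entries of the
    maximum, so only the third can exceed \<open>dist x (f x)\<close>.\<close>
  have "a * dist x (f x) \<le> dist x (f x)" "(1 - a) * dist x (f x) \<le> dist x (f x)"
    using assms(1,2) by (auto intro: mult_left_le_one_le)
  then have "dist x (f x) < (dist x y + dist y (f x)) / 2"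
    using assms(3,4) unfolding M_max_def by (auto simp: less_max_iff_disj)
  moreover have "dist y (f x) \<le> dist x y + dist x (f x)"
    by (metis dist_commute dist_triangle)
  ultimately show ?thesis
    by argo
qed

theorem theorem2p1:
  fixes f :: "'a::metric_space \<Rightarrow> 'a"
    and \<zeta> :: "real \<Rightarrow> real \<Rightarrow> real"
    and a \<rho> :: real
    and x1 x2 :: 'a
  assumes "simulation_function \<zeta>"
    and "0 \<le> a" and "a < 1"
    and "\<rho> = min_displacement f"
    and "\<forall>x \<in> ellipse \<rho> x1 x2. \<exists>\<delta>>0.
           \<rho> / 2 \<le> M_max a f x x1 + M_max a f x x2 \<and>
           M_max a f x x1 + M_max a f x x2 < \<rho> / 2 + \<delta> \<longrightarrow>
           dist (f x) x1 + dist (f x) x2 \<le> \<rho>"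
    and "\<forall>x. dist (f x) x > 0 \<longrightarrow>
           \<zeta> (dist (f x) x) (M_max a f x x1) \<ge> 0 \<and>
           \<zeta> (dist (f x) x) (M_max a f x x2) \<ge> 0"
    and "\<forall>x. dist (f x) x > 0 \<longrightarrow>
           \<zeta> (dist (f x) x)
             ((dist x x1 + dist (f x) x1 + dist x x2 + dist (f x) x2) / 2) \<ge> 0"
  shows "f x1 = x1 \<and> f x2 = x2 \<and> ellipse \<rho> x1 x2 \<subseteq> Fix f"
proof -
  \<comment> \<open>Positivity stays a premise: \<open>M_max_same\<close> provides it at the foci,
    and once these are known to be fixed, \<open>M_max_pos\<close> provides it for every moved
    point.\<close>
  have less: "dist x (f x) < M_max a f x y"
    if "f x \<noteq> x" "0 < M_max a f x y" "y = x1 \<or> y = x2" for x y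
    using simulation_function_nonneg_less[OF assms(1), of "dist x (f x)" "M_max a f x y"]
      assms(6) that by (auto simp: dist_commute)
  have fixed: "f x1 = x1" "f x2 = x2"
    using less[of x1 x1] less[of x2 x2] by (auto simp: M_max_same)
  have "f x = x" if "x \<in> ellipse \<rho> x1 x2" for x
  proof (rule ccontr)
    assume moved: "f x \<noteq> x"
    have "dist x (f x) < 2 * dist x y" if "y = x1 \<or> y = x2" for y
      using dist_less_if_less_M_max[of a f y x] less[of x y] M_max_pos[of a f x y]
        moved fixed that assms(2,3) by auto
    then have "dist x (f x) < 2 * dist x x1" "dist x (f x) < 2 * dist x x2"
      by auto
    moreover have "dist x x1 + dist x x2 = \<rho>"
      using that by (simp add: ellipse_def)
    moreover have "\<rho> \<le> dist x (f x)"
      using min_displacement_le[of f x] moved assms(4) by simp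
    ultimately show False
      by linarith
  qed
  then show ?thesis
    using fixed by (auto simp: Fix_def)
qed

end
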